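(* Let $\mathcal{H}$ be a real Hilbert space, $\alpha,h,L>0$, and let $f_1,\dots,f_m:\mathcal{H}\to\mathbb{R}$ be convex and differentiable. Let $x^0=x^1\in\mathcal{H}$ and for $k\ge 1$ define $$x^{k+1}=x^k+\frac{1}{1+\alpha h}(x^k-x^{k-1})-\frac{h^2}{1+\alpha h}\sum_{i=1}^m\theta_i^k\nabla f_i(x^k),$$ where $\theta^k\in\mathbb{R}^m$ is a solution of $$\min_{\theta\in\mathbb{R}^m}\Big\|h^2\Big(\sum_{i=1}^m\theta_i\nabla f_i(x^k)\Big)-(x^k-x^{k-1})\Big\|^2\quad\text{s.t. }\theta\ge 0,\ \sum_{i=1}^m\theta_i=1.$$ Assume that the gradients $\nabla f_i$, $i=1,\dots,m$, are $L$-Lipschitz continuous on a bounded set containing the sequence $(x^k)_{k\ge 0}$, and assume $Lh<2\alpha$. Then $(x^k)_{k\ge0}$ converges weakly to a Pareto critical point of the multiobjective problem $\min_{x\in\mathcal{H}}(f_1(x),\dots,f_m(x))$.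
   Context: A point $x^*\in\mathcal{H}$ is Pareto critical if there is $\theta\in\mathbb{R}^m$ with $\theta\ge 0$, $\sum_{i=1}^m\theta_i=1$ and $\sum_{i=1}^m\theta_i\nabla f_i(x^* )=0$.
   Formalization: The bounded set on which the gradients are L-Lipschitz is also required to contain the segments between consecutive iterates (automatic if it is convex); for an arbitrary bounded set containing the sequence the claim fails, since the scheme can approach a 3-cycle. *)

theory Defs
  imports "HOL-Analysis.Analysis"
begin

text \<open>
  A real Hilbert space is a type of sort \<open>{real_inner, complete_space}\<close>; it may have any dimension.
  The vector \<open>gradient f x\<close> represents the Frechet derivative of \<open>f\<close> at \<open>x\<close> through the inner
  product. In a Hilbert space it exists and is unique (Riesz) wherever \<open>f\<close> is differentiable;
  elsewhere the value is unspecified.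
\<close>

definition gradient :: "('a::real_inner \<Rightarrow> real) \<Rightarrow> 'a \<Rightarrow> 'a" where
  "gradient f x = (THE D. GDERIV f x :> D)"

definition unit_simplex :: "(real ^ 'm::finite) set" where
  "unit_simplex = {\<theta>. (\<forall>i. 0 \<le> \<theta> $ i) \<and> (\<Sum>i\<in>UNIV. \<theta> $ i) = 1}"

definition pareto_critical :: "('m::finite \<Rightarrow> 'a::real_inner \<Rightarrow> real) \<Rightarrow> 'a \<Rightarrow> bool" where
  "pareto_critical f x \<longleftrightarrow>
     (\<exists>\<theta> \<in> unit_simplex. (\<Sum>i\<in>UNIV. \<theta> $ i *\<^sub>R gradient (f i) x) = 0)"

definition converges_weakly :: "(nat \<Rightarrow> 'a::real_normed_vector) \<Rightarrow> 'a \<Rightarrow> bool" where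
  "converges_weakly x l \<longleftrightarrow>
     (\<forall>\<phi> :: 'a \<Rightarrow> real. bounded_linear \<phi> \<longrightarrow> (\<lambda>k. \<phi> (x k)) \<longlonglongrightarrow> \<phi> l)"

text \<open>
  The predicate below makes precise that the gradients of all \<open>f i\<close> are \<open>L\<close>-Lipschitz on a bounded
  set \<open>S\<close> containing the sequence \<open>x\<close>. The set must contain the segments between consecutive
  iterates as well, which holds in particular for every convex \<open>S\<close> (such as a ball) containing the
  sequence. Some condition of this kind is needed: if the Lipschitz estimate were available
  only between the iterates themselves, then the descent inequality with constant \<open>L / 2\<close> could
  fail, and the scheme can approach a 3-cycle even for one smooth convex function on the plane.
\<close>

definition lipschitz_gradients_along ::
  "real \<Rightarrow> ('m \<Rightarrow> 'a::real_inner \<Rightarrow> real) \<Rightarrow> (nat \<Rightarrow> 'a) \<Rightarrow> 'a set \<Rightarrow> bool" where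
  "lipschitz_gradients_along L f x S \<longleftrightarrow>
     bounded S \<and> range x \<subseteq> S \<and> (\<forall>k. closed_segment (x k) (x (Suc k)) \<subseteq> S) \<and>
     (\<forall>i. L-lipschitz_on S (gradient (f i)))"

end

theory Submission
  imports Defs
begin

text \<open>
  Write \<open>v k = x k - x (k - 1)\<close> and let \<open>g k\<close> be the combination of gradients chosen at step \<open>k\<close>.
  The recursion is the implicitly damped equation \<open>(1 + \<alpha> h) v (k + 1) = v k - h\<^sup>2 g k\<close>, and the choice
  of \<open>\<theta> k\<close> says that \<open>h\<^sup>2 g k\<close> is the projection of \<open>v k\<close> onto the convex hull of the
  \<open>h\<^sup>2 \<nabla>f\<^sub>i (x k)\<close>. The residual of this projection is a positive multiple of \<open>v (k + 1)\<close>, so the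
  variational inequality of the projection reads
  \<open>\<langle>v (k + 1), \<nabla>f\<^sub>i (x k)\<rangle> \<le> \<langle>v (k + 1), g k\<rangle>\<close> for all \<open>i\<close>
  (\<open>steepest_common_direction\<close>). Together with the descent inequality it makes every energy
  \<open>f\<^sub>i (x k) + \<parallel>v k\<parallel>\<^sup>2 / (2 h\<^sup>2)\<close> decrease by at least
  \<open>(\<alpha> / h - L / 2) \<parallel>v (k + 1)\<parallel>\<^sup>2\<close> (\<open>energy_decrease\<close>). The energies are bounded below because the
  iterates are bounded, hence \<open>\<parallel>v k\<parallel>\<^sup>2\<close> is summable, \<open>g k\<close> tends to 0, and \<open>f\<^sub>i (x k)\<close> has a
  limit \<open>\<ell>\<^sub>i\<close>.

  Let \<open>Z\<close> be the set of points \<open>z\<close> with \<open>f\<^sub>i z \<le> \<ell>\<^sub>i\<close> for all \<open>i\<close>. The conclusion follows from three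
  facts about \<open>Z\<close>.
  The distance from \<open>x k\<close> to any point of \<open>Z\<close> converges (\<open>distance_convergent\<close>), since
  \<open>f\<^sub>i z - f\<^sub>i (x k) \<le> \<parallel>v k\<parallel>\<^sup>2 / (2 h\<^sup>2)\<close> controls the sign of \<open>\<langle>g k, z - x k\<rangle>\<close> up to a summable error.
  Every weak cluster point of the iterates lies in \<open>Z\<close>, as convex continuous functions are weakly
  lower semicontinuous. Every point of \<open>Z\<close> is Pareto critical
  (\<open>below_limit_values_pareto_critical\<close>): along a subsequence on which \<open>\<theta> k\<close> converges, the convexity
  inequalities at \<open>x k\<close> show in the limit that the point minimises the limiting weighted sum. The
  first two facts and Opial's argument (\<open>opial_weak_convergence\<close>) give weak convergence to a point of
  \<open>Z\<close>.

  Weak compactness is used only in the following elementary form. A weak cluster point of a bounded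
  sequence is replaced by a point common to the closed convex hulls of all its tails; such a point
  exists because nested bounded closed convex sets in a Hilbert space meet. The same principle
  yields minimal norm points, hence the Riesz representation that provides the gradients.
\<close>

section \<open>Nested convex sets and weak cluster points\<close>

text \<open>
  Almost minimal norm points of the sets form a Cauchy sequence: the midpoint of the \<open>m\<close>-th and a
  later point stays in the \<open>m\<close>-th set, so its norm cannot be much smaller than those of the end points,
  and the parallelogram law bounds their distance. The limit lies in all the sets.
\<close>

lemma nested_closed_convex_Inter_nonempty:
  fixes K :: "nat \<Rightarrow> 'a::{real_inner, complete_space} set"
  assumes dec: "decseq K" and conv: "\<And>n. convex (K n)" and clo: "\<And>n. closed (K n)"
    and ne: "\<And>n. K n \<noteq> {}" and bdd: "bounded (K 0)"
  shows "(\<Inter>n. K n) \<noteq> {}"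
proof -
  define d where "d n = (INF z\<in>K n. (norm z)\<^sup>2)" for n
  have bb: "bdd_below ((\<lambda>z. (norm z)\<^sup>2) ` K n)" for n
    by (rule bdd_belowI2[of _ 0]) simp
  have d_le: "d n \<le> (norm z)\<^sup>2" if "z \<in> K n" for n z
    unfolding d_def by (rule cINF_lower[OF bb that])
  have sub: "K n \<subseteq> K m" if "m \<le> n" for m n
    using dec that by (auto simp: decseq_def)
  have "incseq d"
    unfolding incseq_def d_def using cINF_superset_mono[OF ne bb sub] by simp
  obtain B where B: "\<And>z. z \<in> K 0 \<Longrightarrow> norm z \<le> B"
    using bdd by (auto simp: bounded_iff)
  have dB: "d n \<le> B\<^sup>2" for n
  proof -
    obtain z where z: "z \<in> K n" using ne by blast
    then have "norm z \<le> B" using sub[of 0 n] B by auto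
    then have "(norm z)\<^sup>2 \<le> B\<^sup>2" by (simp add: power_mono)
    then show ?thesis using d_le[OF z] by simp
  qed
  obtain D where D: "d \<longlonglongrightarrow> D"
    using incseq_convergent[OF \<open>incseq d\<close>, of "B\<^sup>2"] dB by blast
  have "\<exists>z\<in>K n. (norm z)\<^sup>2 < d n + 1 / real (Suc n)" for n
    using cINF_less_iff[OF ne bb, of n "d n + 1 / real (Suc n)"] by (simp add: d_def)
  then obtain p where pK: "\<And>n. p n \<in> K n"
    and pd: "\<And>n. (norm (p n))\<^sup>2 < d n + 1 / real (Suc n)"
    by metis
  have est: "(norm (p m - p n))\<^sup>2 \<le> 2 * (d n - d m) + 4 / real (Suc m)" if "m \<le> n" for m n
  proof -
    have "(1/2) *\<^sub>R p m + (1/2) *\<^sub>R p n \<in> K m"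
      using conv[of m] pK[of m] pK[of n] sub[OF that] by (intro convexD) auto
    then have "d m \<le> (norm ((1/2) *\<^sub>R p m + (1/2) *\<^sub>R p n))\<^sup>2" by (rule d_le)
    \<comment> \<open>Parallelogram law.\<close>
    moreover have "(norm (p m - p n))\<^sup>2
        = 2 * (norm (p m))\<^sup>2 + 2 * (norm (p n))\<^sup>2 - 4 * (norm ((1/2) *\<^sub>R p m + (1/2) *\<^sub>R p n))\<^sup>2"
      by (simp add: power2_norm_eq_inner inner_simps inner_commute algebra_simps)
    moreover have "1 / real (Suc n) \<le> 1 / real (Suc m)"
      using that by (simp add: frac_le)
    ultimately show ?thesis using pd[of m] pd[of n] by simp
  qed
  have "Cauchy p"
  proof (rule metric_CauchyI)
    fix e :: real assume "e > 0"
    have "Cauchy d" using D by (rule LIMSEQ_imp_Cauchy)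
    then obtain M1 where M1: "\<And>m n. m \<ge> M1 \<Longrightarrow> n \<ge> M1 \<Longrightarrow> dist (d m) (d n) < e\<^sup>2 / 4"
      using metric_CauchyD[OF \<open>Cauchy d\<close>, of "e\<^sup>2 / 4"] \<open>e > 0\<close> by auto
    obtain M2 where M2: "8 / e\<^sup>2 < real M2" using reals_Archimedean2 by blast
    have less: "dist (p m) (p n) < e" if "M1 \<le> m" "M2 \<le> m" "m \<le> n" for m n
    proof -
      have "8 / e\<^sup>2 < real (Suc m)" using M2 that by linarith
      then have "4 / real (Suc m) < e\<^sup>2 / 2" using \<open>e > 0\<close> by (simp add: field_simps)
      moreover have "d n - d m < e\<^sup>2 / 4" using M1[of n m] that unfolding dist_real_def by linarith
      moreover have "A < E" if "A \<le> 2 * B + C" "C < E / 2" "B < E / 4" for A B C E :: real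
        using that by simp
      ultimately have "(norm (p m - p n))\<^sup>2 < e\<^sup>2" using est[OF that(3)] by blast
      then show ?thesis using \<open>e > 0\<close> by (simp add: dist_norm power2_less_imp_less)
    qed
    show "\<exists>M. \<forall>m\<ge>M. \<forall>n\<ge>M. dist (p m) (p n) < e"
    proof (intro exI allI impI)
      fix m n assume "max M1 M2 \<le> m" "max M1 M2 \<le> n"
      then show "dist (p m) (p n) < e"
        using less[of m n] less[of n m] by (cases "m \<le> n") (auto simp: dist_commute)
    qed
  qed
  then obtain q where q: "p \<longlonglongrightarrow> q" by (auto simp: Cauchy_convergent_iff convergent_def)
  have "q \<in> K n" for n
  proof (rule closed_sequentially[OF clo])
    show "(\<lambda>k. p (k + n)) \<longlonglongrightarrow> q" using q by (rule LIMSEQ_ignore_initial_segment)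
    show "p (k + n) \<in> K n" for k using pK[of "k + n"] sub[of n "k + n"] by auto
  qed
  then show ?thesis by blast
qed

text \<open>
  The points common to all \<open>tail_hull u n\<close> play the role of weak cluster points of \<open>u\<close>. For a sequence
  with several weak limits there are more of them than weak limits, since each hull is convex; the
  arguments below remain valid for this larger set when they are applied to all subsequences.
\<close>

definition tail_hull :: "(nat \<Rightarrow> 'a::real_normed_vector) \<Rightarrow> nat \<Rightarrow> 'a set" where
  "tail_hull u n = closure (convex hull (u ` {n..}))"

lemma tail_hull_Inter_nonempty:
  fixes u :: "nat \<Rightarrow> 'a::{real_inner, complete_space}"
  assumes "bounded (range u)"
  obtains p where "\<And>n. p \<in> tail_hull u n"
proof -
  have "(\<Inter>n. tail_hull u n) \<noteq> {}"
  proof (rule nested_closed_convex_Inter_nonempty)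
    show "decseq (tail_hull u)"
      unfolding decseq_def tail_hull_def
      by (intro allI impI closure_mono hull_mono image_mono) auto
    show "bounded (tail_hull u 0)"
      unfolding tail_hull_def using assms
      by (intro bounded_closure bounded_convex_hull) (auto simp: atLeast_0)
    show "convex (tail_hull u n)" for n
      unfolding tail_hull_def by (intro convex_closure convex_convex_hull)
    show "closed (tail_hull u n)" for n
      unfolding tail_hull_def by simp
    show "tail_hull u n \<noteq> {}" for n
      unfolding tail_hull_def by auto
  qed
  then show thesis using that by auto
qed

lemma convex_on_sublevel:
  assumes "convex_on UNIV \<phi>"
  shows "convex {z. \<phi> z \<le> c}"
proof (rule convexI)
  fix a b :: 'a and s t :: real
  assume ab: "a \<in> {z. \<phi> z \<le> c}" "b \<in> {z. \<phi> z \<le> c}" and st: "0 \<le> s" "0 \<le> t" "s + t = 1"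
  have "\<phi> (s *\<^sub>R a + t *\<^sub>R b) \<le> s * \<phi> a + t * \<phi> b"
    using assms st by (auto simp: convex_on_def)
  also have "\<dots> \<le> s * c + t * c"
    using ab st by (intro add_mono mult_left_mono) auto
  also have "\<dots> = c" using st by (simp flip: distrib_right)
  finally show "s *\<^sub>R a + t *\<^sub>R b \<in> {z. \<phi> z \<le> c}" by simp
qed

text \<open>
  Weak lower semicontinuity in disguise: a sublevel set of \<open>\<phi>\<close> is closed and convex, so it contains
  the whole closed hull of a tail as soon as it contains the tail.
\<close>

lemma convex_le_on_tail_hull:
  fixes \<phi> :: "'a::real_normed_vector \<Rightarrow> real"
  assumes conv: "convex_on UNIV \<phi>" and cont: "continuous_on UNIV \<phi>"
    and p: "\<And>n. p \<in> tail_hull u n" and ev: "\<forall>\<^sub>F k in sequentially. \<phi> (u k) \<le> c"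
  shows "\<phi> p \<le> c"
proof -
  obtain N where N: "\<And>k. k \<ge> N \<Longrightarrow> \<phi> (u k) \<le> c"
    using ev by (auto simp: eventually_sequentially)
  have "convex hull (u ` {N..}) \<subseteq> {z. \<phi> z \<le> c}"
    using N convex_on_sublevel[OF conv] by (intro hull_minimal) auto
  moreover have "closed {z. \<phi> z \<le> c}"
    using closed_Collect_le[of \<phi> "\<lambda>_. c"] cont by simp
  ultimately have "tail_hull u N \<subseteq> {z. \<phi> z \<le> c}"
    unfolding tail_hull_def by (rule closure_minimal)
  then show ?thesis using p[of N] by auto
qed

lemma convex_le_limit_on_tail_hull:
  fixes \<phi> :: "'a::real_normed_vector \<Rightarrow> real"
  assumes "convex_on UNIV \<phi>" and "continuous_on UNIV \<phi>"
    and "\<And>n. p \<in> tail_hull u n" and lim: "(\<lambda>k. \<phi> (u k)) \<longlonglongrightarrow> c"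
  shows "\<phi> p \<le> c"
proof (rule field_le_epsilon)
  fix e :: real assume "e > 0"
  then have "\<forall>\<^sub>F k in sequentially. \<phi> (u k) < c + e"
    using lim by (intro order_tendstoD) auto
  then have "\<forall>\<^sub>F k in sequentially. \<phi> (u k) \<le> c + e"
    by eventually_elim simp
  then show "\<phi> p \<le> c + e" using assms by (intro convex_le_on_tail_hull)
qed

lemma bounded_linear_convex_continuous:
  assumes "bounded_linear (\<phi> :: 'a::real_normed_vector \<Rightarrow> real)"
  shows "convex_on UNIV \<phi>" "continuous_on UNIV \<phi>"
proof -
  interpret bounded_linear \<phi> by fact
  show "convex_on UNIV \<phi>" by (auto simp: convex_on_def add scaleR)
  show "continuous_on UNIV \<phi>" by (intro continuous_on continuous_on_id)
qed

lemma bounded_linear_limit_on_tail_hull: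
  fixes \<phi> :: "'a::real_normed_vector \<Rightarrow> real"
  assumes bl: "bounded_linear \<phi>" and p: "\<And>n. p \<in> tail_hull u n"
    and lim: "(\<lambda>k. \<phi> (u k)) \<longlonglongrightarrow> c"
  shows "\<phi> p = c"
proof (rule antisym)
  show "\<phi> p \<le> c"
    by (rule convex_le_limit_on_tail_hull[OF bounded_linear_convex_continuous[OF bl] p lim])
  have "- \<phi> p \<le> - c"
    by (rule convex_le_limit_on_tail_hull[OF _ _ p tendsto_minus[OF lim]])
      (intro bounded_linear_convex_continuous bounded_linear_minus bl)+
  then show "c \<le> \<phi> p" by simp
qed

text \<open>
  Convergence of the distances to \<open>p\<close> and \<open>q\<close> forces the linear functional \<open>\<langle>_, p - q\<rangle>\<close> to converge along
  the sequence, by polarisation. Its limit is also its value at every common point of tail hulls, so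
  two such points in \<open>Z\<close> coincide, even if they come from different subsequences. If some functional
  failed to converge, a subsequence would keep its values away from the value at \<open>p\<close>, on one side, and the common
  points of the tail hulls of that subsequence would differ from \<open>p\<close>.
\<close>

lemma opial_weak_convergence:
  fixes x :: "nat \<Rightarrow> 'a::{real_inner, complete_space}"
  assumes bdd: "bounded (range x)"
    and dist: "\<And>z. z \<in> Z \<Longrightarrow> convergent (\<lambda>k. (norm (x k - z))\<^sup>2)"
    and cluster: "\<And>r p. strict_mono r \<Longrightarrow> (\<And>n. p \<in> tail_hull (x \<circ> r) n) \<Longrightarrow> p \<in> Z"
  obtains p where "p \<in> Z" "converges_weakly x p"
proof -
  obtain p where p: "\<And>n. p \<in> tail_hull x n" using tail_hull_Inter_nonempty[OF bdd] by blast
  have pZ: "p \<in> Z" using cluster[of id p] p by (simp add: strict_mono_def)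
  have unique: "q = p" if r: "strict_mono r" and q: "\<And>n. q \<in> tail_hull (x \<circ> r) n" for q r
  proof -
    have qZ: "q \<in> Z" using cluster r q by blast
    obtain a b where a: "(\<lambda>k. (norm (x k - p))\<^sup>2) \<longlonglongrightarrow> a" and b: "(\<lambda>k. (norm (x k - q))\<^sup>2) \<longlonglongrightarrow> b"
      using dist[OF pZ] dist[OF qZ] by (auto simp: convergent_def)
    have eq: "inner (x k) (p - q)
        = ((norm (x k - q))\<^sup>2 - (norm (x k - p))\<^sup>2 + ((norm p)\<^sup>2 - (norm q)\<^sup>2)) / 2" for k
      by (simp add: power2_norm_eq_inner inner_simps inner_commute algebra_simps)
    define c where "c = (b - a + ((norm p)\<^sup>2 - (norm q)\<^sup>2)) / 2"
    have lim: "(\<lambda>k. inner (x k) (p - q)) \<longlonglongrightarrow> c"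
      unfolding eq c_def by (intro tendsto_intros a b) simp
    have bl: "bounded_linear (\<lambda>z. inner z (p - q))" by (rule bounded_linear_inner_left)
    have "inner p (p - q) = c" by (rule bounded_linear_limit_on_tail_hull[OF bl p lim])
    moreover have "inner q (p - q) = c"
      using LIMSEQ_subseq_LIMSEQ[OF lim r]
      by (intro bounded_linear_limit_on_tail_hull[OF bl q]) (simp add: o_def)
    ultimately have "inner (p - q) (p - q) = 0" by (simp add: inner_diff_left)
    then show ?thesis by simp
  qed
  have upper: "\<forall>\<^sub>F k in sequentially. \<phi> (x k) < \<phi> p + e"
    if bl: "bounded_linear \<phi>" and "e > 0" for \<phi> :: "'a \<Rightarrow> real" and e
  proof (rule ccontr)
    assume "\<not> ?thesis"
    then have "\<exists>\<^sub>F k in sequentially. \<phi> p + e \<le> \<phi> (x k)"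
      by (simp add: frequently_def not_le)
    then have "infinite {k. \<phi> p + e \<le> \<phi> (x k)}"
      by (simp add: frequently_cofinite flip: cofinite_eq_sequentially)
    then obtain r :: "nat \<Rightarrow> nat" where r: "strict_mono r" "\<And>n. r n \<in> {k. \<phi> p + e \<le> \<phi> (x k)}"
      by (rule infinite_enumerate[THEN exE]) auto
    have "bounded (range (x \<circ> r))" by (rule bounded_subset[OF bdd]) auto
    then obtain q where q: "\<And>n. q \<in> tail_hull (x \<circ> r) n"
      using tail_hull_Inter_nonempty by blast
    have "- \<phi> ((x \<circ> r) k) \<le> - (\<phi> p + e)" for k
      unfolding neg_le_iff_le using r(2)[of k] by simp
    then have "\<forall>\<^sub>F k in sequentially. - \<phi> ((x \<circ> r) k) \<le> - (\<phi> p + e)"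
      by simp
    then have "- \<phi> q \<le> - (\<phi> p + e)"
      by (intro convex_le_on_tail_hull[OF _ _ q] bounded_linear_convex_continuous
          bounded_linear_minus bl)
    then show False using unique[OF r(1) q] \<open>e > 0\<close> by simp
  qed
  have "converges_weakly x p"
    unfolding converges_weakly_def
  proof (intro allI impI)
    fix \<phi> :: "'a \<Rightarrow> real" assume bl: "bounded_linear \<phi>"
    show "(\<lambda>k. \<phi> (x k)) \<longlonglongrightarrow> \<phi> p"
    proof (rule order_tendstoI)
      fix a assume "a < \<phi> p"
      then show "\<forall>\<^sub>F k in sequentially. a < \<phi> (x k)"
        using upper[OF bounded_linear_minus[OF bl], of "\<phi> p - a"] by simp
    next
      fix a assume "\<phi> p < a"
      then show "\<forall>\<^sub>F k in sequentially. \<phi> (x k) < a"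
        using upper[OF bl, of "a - \<phi> p"] by simp
    qed
  qed
  then show thesis using that pZ by blast
qed

section \<open>Gradients\<close>

text \<open>
  A minimal norm point \<open>p\<close> of the hyperplane \<open>\<phi> = 1\<close> is orthogonal to the kernel of \<open>\<phi>\<close>, and
  \<open>v - \<phi> v *\<^sub>R p\<close> lies in the kernel. The minimal norm point is found in the intersection of the
  hyperplane with shrinking balls.
\<close>

lemma riesz_representation:
  fixes \<phi> :: "'a::{real_inner, complete_space} \<Rightarrow> real"
  assumes bl: "bounded_linear \<phi>"
  obtains D where "\<And>v. \<phi> v = inner v D"
proof (cases "\<forall>v. \<phi> v = 0")
  case True
  then show thesis using that[of 0] by simp
next
  case False
  interpret bounded_linear \<phi> by fact
  obtain w where w: "\<phi> w \<noteq> 0" using False by blast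
  define A where "A = {z. \<phi> z = 1}"
  have A_ne: "w /\<^sub>R \<phi> w \<in> A" using w by (simp add: A_def scaleR)
  have A_conv: "convex A" by (auto simp: A_def convex_def add scaleR)
  have A_clo: "closed A"
    unfolding A_def using bounded_linear_convex_continuous(2)[OF bl]
    by (intro closed_Collect_eq) auto
  define \<rho> where "\<rho> = infdist 0 A"
  define K where "K n = A \<inter> cball 0 (\<rho> + 1 / real (Suc n))" for n
  have "(\<Inter>n. K n) \<noteq> {}"
  proof (rule nested_closed_convex_Inter_nonempty)
    show "decseq K"
      unfolding decseq_def K_def by (intro allI impI Int_mono subset_refl subset_cball) (simp add: frac_le)
    show "convex (K n)" for n unfolding K_def by (intro convex_Int A_conv convex_cball)
    show "closed (K n)" for n unfolding K_def by (intro closed_Int A_clo closed_cball)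
    show "bounded (K 0)" unfolding K_def by (rule bounded_subset[OF bounded_cball]) auto
    show "K n \<noteq> {}" for n
    proof -
      have "\<exists>a\<in>A. dist 0 a < \<rho> + 1 / real (Suc n)"
        using A_ne cINF_less_iff[of A "dist 0" "\<rho> + 1 / real (Suc n)"] bdd_belowI2[of A 0 norm]
        by (auto simp: \<rho>_def infdist_def)
      then show ?thesis unfolding K_def by fastforce
    qed
  qed
  then obtain p where pK: "\<And>n. p \<in> K n" by blast
  then have pA: "p \<in> A" by (auto simp: K_def)
  have "norm p \<le> \<rho>"
  proof (rule LIMSEQ_le_const)
    show "(\<lambda>n. \<rho> + 1 / real (Suc n)) \<longlonglongrightarrow> \<rho>"
      using tendsto_add[OF tendsto_const LIMSEQ_Suc[OF lim_1_over_n], of \<rho>] by simp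
    show "\<exists>N. \<forall>n\<ge>N. norm p \<le> \<rho> + 1 / real (Suc n)" using pK by (auto simp: K_def)
  qed
  then have min: "\<forall>z\<in>A. dist 0 p \<le> dist 0 z"
    using infdist_le[of _ A "0::'a"] by (force simp: \<rho>_def)
  have orth: "inner z p = 0" if "\<phi> z = 0" for z
  proof -
    have "p + z \<in> A" "p - z \<in> A" using pA that by (auto simp: A_def add diff)
    from this[THEN any_closest_point_dot[OF A_conv A_clo pA _ min]]
    show ?thesis by (simp add: inner_commute)
  qed
  have "p \<noteq> 0" using pA zero by (auto simp: A_def)
  have "\<phi> v = inner v (p /\<^sub>R (norm p)\<^sup>2)" for v
  proof -
    have "inner (v - \<phi> v *\<^sub>R p) p = 0"
      using pA by (intro orth) (simp add: A_def diff scaleR)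
    then show ?thesis using \<open>p \<noteq> 0\<close>
      by (simp add: inner_diff_left power2_norm_eq_inner field_simps)
  qed
  then show thesis by (rule that)
qed

lemma gradient_unique:
  assumes "GDERIV f x :> D" "GDERIV f x :> D'"
  shows "D = D'"
proof -
  have "(\<lambda>v. inner v D) = (\<lambda>v. inner v D')"
    using assms unfolding gderiv_def by (rule has_derivative_unique)
  then have "inner (D - D') D = inner (D - D') D'" by metis
  then have "inner (D - D') (D - D') = 0" by (simp add: inner_diff_right)
  then show ?thesis by simp
qed

lemma gderiv_gradient:
  fixes f :: "'a::{real_inner, complete_space} \<Rightarrow> real"
  assumes "f differentiable (at x)"
  shows "GDERIV f x :> gradient f x"
proof -
  obtain f' where f': "(f has_derivative f') (at x)" using assms by (auto simp: differentiable_def)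
  obtain D where "\<And>v. f' v = inner v D"
    using riesz_representation[OF has_derivative_bounded_linear[OF f']] by blast
  then have "f' = (\<lambda>v. inner v D)" by blast
  with f' have "GDERIV f x :> D" by (simp add: gderiv_def)
  then show ?thesis
    unfolding gradient_def by (rule theI) (rule gradient_unique[OF _ \<open>GDERIV f x :> D\<close>])
qed

lemma has_real_derivative_along_line:
  fixes f :: "'a::{real_inner, complete_space} \<Rightarrow> real"
  assumes "\<And>z. f differentiable (at z)"
  shows "((\<lambda>t. f (a + t *\<^sub>R v)) has_real_derivative inner (gradient f (a + t *\<^sub>R v)) v) (at t)"
proof -
  have "(f has_derivative (\<lambda>w. inner w (gradient f (a + t *\<^sub>R v)))) (at (a + t *\<^sub>R v))"
    using gderiv_gradient[OF assms] by (simp add: gderiv_def)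
  moreover have "((\<lambda>t. a + t *\<^sub>R v) has_derivative (\<lambda>s. s *\<^sub>R v)) (at t)"
    by (auto intro!: derivative_eq_intros)
  ultimately have "((\<lambda>t. f (a + t *\<^sub>R v)) has_derivative
      (\<lambda>s. inner (s *\<^sub>R v) (gradient f (a + t *\<^sub>R v)))) (at t)"
    using has_derivative_compose by fastforce
  then show ?thesis
    by (simp add: has_field_derivative_def inner_commute mult_commute_abs)
qed

text \<open>
  The restriction of \<open>f\<close> to the line through \<open>a\<close> and \<open>b\<close> is convex on the reals and lies above its tangent.
\<close>

lemma convex_gradient_inequality:
  fixes f :: "'a::{real_inner, complete_space} \<Rightarrow> real"
  assumes conv: "convex_on UNIV f" and diff: "\<And>z. f differentiable (at z)"
  shows "f a + inner (gradient f a) (b - a) \<le> f b"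
proof -
  define g where "g t = f (a + t *\<^sub>R (b - a))" for t
  have "convex_on UNIV g"
  proof (rule convex_onI)
    fix t s s' :: real assume t: "0 < t" "t < 1"
    have "a + ((1 - t) * s + t * s') *\<^sub>R (b - a)
        = (1 - t) *\<^sub>R (a + s *\<^sub>R (b - a)) + t *\<^sub>R (a + s' *\<^sub>R (b - a))"
      by (simp add: algebra_simps)
    then show "g ((1 - t) *\<^sub>R s + t *\<^sub>R s') \<le> (1 - t) * g s + t * g s'"
      using convex_onD[OF conv, of t "a + s *\<^sub>R (b - a)" "a + s' *\<^sub>R (b - a)"] t by (simp add: g_def)
  qed simp
  moreover have "(g has_real_derivative inner (gradient f a) (b - a)) (at 0)"
    using has_real_derivative_along_line[OF diff, of a "b - a" 0] by (simp add: g_def[abs_def])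
  ultimately have "g 1 - g 0 \<ge> inner (gradient f a) (b - a) * (1 - 0)"
    by (intro convex_on_imp_above_tangent[where A = UNIV]) auto
  then show ?thesis by (simp add: g_def)
qed

text \<open>
  Along the segment, \<open>f\<close> minus the quadratic upper bound has a nonpositive derivative.
\<close>

lemma descent_inequality:
  fixes f :: "'a::{real_inner, complete_space} \<Rightarrow> real"
  assumes diff: "\<And>z. f differentiable (at z)"
    and lip: "L-lipschitz_on (closed_segment a b) (gradient f)"
  shows "f b \<le> f a + inner (gradient f a) (b - a) + L / 2 * (norm (b - a))\<^sup>2"
proof -
  define v where "v = b - a"
  define g where "g t = f (a + t *\<^sub>R v) - t * inner (gradient f a) v - L / 2 * t\<^sup>2 * (norm v)\<^sup>2" for t
  have "g 1 \<le> g 0"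
  proof (rule DERIV_nonpos_imp_nonincreasing[where f = g and a = 0 and b = 1])
    fix t :: real assume t: "0 \<le> t" "t \<le> 1"
    let ?z = "a + t *\<^sub>R v"
    have "?z \<in> closed_segment a b"
      using t unfolding in_segment v_def by (intro exI[of _ t]) (simp add: algebra_simps)
    then have "dist (gradient f ?z) (gradient f a) \<le> L * dist ?z a"
      by (intro lipschitz_onD[OF lip]) auto
    then have "norm (gradient f ?z - gradient f a) \<le> L * t * norm v"
      using t by (simp add: dist_norm)
    then have "norm (gradient f ?z - gradient f a) * norm v \<le> L * t * norm v * norm v"
      by (rule mult_right_mono) simp
    then have "inner (gradient f ?z - gradient f a) v \<le> L * t * (norm v)\<^sup>2"
      using norm_cauchy_schwarz[of "gradient f ?z - gradient f a" v]
      by (simp add: power2_eq_square mult.assoc)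
    moreover have "(g has_real_derivative
        inner (gradient f ?z) v - inner (gradient f a) v - L * t * (norm v)\<^sup>2) (at t)"
      unfolding g_def[abs_def]
      by (rule derivative_eq_intros has_real_derivative_along_line[OF diff] refl)+ simp
    ultimately show "\<exists>y. (g has_real_derivative y) (at t) \<and> y \<le> 0"
      by (intro exI conjI) (auto simp: inner_diff_left)
  qed simp
  then show ?thesis by (simp add: g_def v_def)
qed

section \<open>Convergence criteria and the unit simplex\<close>

text \<open>
  Subtracting the partial sums of the errors leaves a decreasing sequence that is bounded below.
\<close>

lemma almost_decreasing_convergent:
  fixes W \<delta> :: "nat \<Rightarrow> real"
  assumes step: "\<And>k. W (Suc k) \<le> W k + \<delta> k" and sm: "summable \<delta>" and low: "\<And>k. B \<le> W k"
  shows "convergent W"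
proof -
  define Y where "Y k = W k - (\<Sum>j<k. \<delta> j)" for k
  have sums: "(\<lambda>k. \<Sum>j<k. \<delta> j) \<longlonglongrightarrow> suminf \<delta>"
    using sm by (rule summable_LIMSEQ)
  then obtain M where M: "\<And>k. \<bar>\<Sum>j<k. \<delta> j\<bar> \<le> M"
    using convergent_imp_Bseq[THEN BseqD] by (force simp: convergent_def)
  have "decseq Y" unfolding decseq_Suc_iff Y_def using step by (simp add: algebra_simps)
  moreover have "\<forall>k. B - M \<le> Y k"
    using low M unfolding Y_def by (metis abs_le_D1 diff_mono)
  ultimately obtain l where "Y \<longlonglongrightarrow> l"
    using decseq_convergent[of Y "B - M"] by metis
  then have "(\<lambda>k. Y k + (\<Sum>j<k. \<delta> j)) \<longlonglongrightarrow> l + suminf \<delta>"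
    using sums by (rule tendsto_add)
  then show ?thesis by (auto simp: Y_def convergent_def)
qed

lemma tendsto_inner_zero_bounded:
  fixes u w :: "nat \<Rightarrow> 'a::real_inner"
  assumes u: "u \<longlonglongrightarrow> 0" and w: "bounded (range w)"
  shows "(\<lambda>k. inner (u k) (w k)) \<longlonglongrightarrow> 0"
proof -
  obtain B where B: "\<And>k. norm (w k) \<le> B" using w by (auto simp: bounded_iff)
  have "\<bar>inner (u k) (w k)\<bar> \<le> norm (u k) * B" for k
    using Cauchy_Schwarz_ineq2[of "u k" "w k"] mult_left_mono[OF B[of k], of "norm (u k)"] by simp
  moreover have "(\<lambda>k. norm (u k) * B) \<longlonglongrightarrow> 0"
    using tendsto_mult_left_zero[OF tendsto_norm_zero[OF u]] .
  ultimately show ?thesis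
    using Lim_null_comparison[of "\<lambda>k. inner (u k) (w k)" "\<lambda>k. norm (u k) * B" sequentially] by simp
qed

lemma compact_unit_simplex: "compact (unit_simplex :: (real ^ 'm::finite) set)"
proof -
  have "closed {\<eta> :: real ^ 'm. (\<forall>i. 0 \<le> \<eta> $ i) \<and> (\<Sum>i\<in>UNIV. \<eta> $ i) = 1}"
    by (intro closed_Collect_conj closed_Collect_all closed_Collect_le closed_Collect_eq
        continuous_intros)
  moreover have "norm \<eta> \<le> 1" if "\<eta> \<in> unit_simplex" for \<eta> :: "real ^ 'm"
    using norm_le_l1_cart[of \<eta>] that by (simp add: unit_simplex_def)
  then have "bounded (unit_simplex :: (real ^ 'm) set)" by (auto simp: bounded_iff)
  ultimately show ?thesis by (simp add: unit_simplex_def compact_eq_bounded_closed)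
qed

lemma convex_unit_simplex: "convex (unit_simplex :: (real ^ 'm::finite) set)"
  by (rule convexI) (auto simp: unit_simplex_def sum.distrib simp flip: sum_distrib_left)

lemma axis_in_unit_simplex: "axis i 1 \<in> unit_simplex"
  by (auto simp: unit_simplex_def axis_def)

section \<open>The inertial scheme\<close>

locale inertial_multiobjective_scheme =
  fixes f :: "'m::finite \<Rightarrow> 'a::{real_inner, complete_space} \<Rightarrow> real"
    and x :: "nat \<Rightarrow> 'a"
    and \<theta> :: "nat \<Rightarrow> real ^ 'm"
    and \<alpha> h L :: real
    and S :: "'a set"
  assumes alpha_pos: "\<alpha> > 0" and h_pos: "h > 0"
    and convex_f: "\<And>i. convex_on UNIV (f i)"
    and differentiable_f: "\<And>i y. f i differentiable (at y)"
    and start: "x 0 = x 1"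
    and scheme: "\<And>k. k \<ge> 1 \<Longrightarrow>
           x (k + 1) = x k + (1 / (1 + \<alpha> * h)) *\<^sub>R (x k - x (k - 1))
             - (h\<^sup>2 / (1 + \<alpha> * h)) *\<^sub>R (\<Sum>i\<in>UNIV. \<theta> k $ i *\<^sub>R gradient (f i) (x k))"
    and argmin: "\<And>k. k \<ge> 1 \<Longrightarrow>
           is_arg_min
             (\<lambda>\<eta>. (norm (h\<^sup>2 *\<^sub>R (\<Sum>i\<in>UNIV. \<eta> $ i *\<^sub>R gradient (f i) (x k)) - (x k - x (k - 1))))\<^sup>2)
             (\<lambda>\<eta>. \<eta> \<in> unit_simplex) (\<theta> k)"
    and lipschitz: "lipschitz_gradients_along L f x S"
    and step_size: "L * h < 2 * \<alpha>"
begin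

text \<open>
  Truncated subtraction gives \<open>v 0 = 0\<close>, and \<open>x 0 = x 1\<close> gives \<open>v 1 = 0\<close>. The estimates for \<open>k \<ge> 1\<close>
  that involve only \<open>x\<close> and \<open>v\<close> therefore extend to \<open>k = 0\<close>.
\<close>

definition v :: "nat \<Rightarrow> 'a" where "v k = x k - x (k - 1)"

definition g :: "nat \<Rightarrow> 'a" where "g k = (\<Sum>i\<in>UNIV. \<theta> k $ i *\<^sub>R gradient (f i) (x k))"

definition energy :: "'m \<Rightarrow> nat \<Rightarrow> real" where
  "energy i k = f i (x k) + (norm (v k))\<^sup>2 / (2 * h\<^sup>2)"

definition limit_value :: "'m \<Rightarrow> real" where "limit_value i = lim (energy i)"

lemma c_pos: "1 + \<alpha> * h > 0"
  using alpha_pos h_pos by (simp add: add_pos_pos)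

lemma v_start: "v 0 = 0" "v (Suc 0) = 0"
  using start by (simp_all add: v_def)

lemma theta_simplex: "k \<ge> 1 \<Longrightarrow> \<theta> k \<in> unit_simplex"
  using argmin by (auto simp: is_arg_min_def)

lemma bounded_x: "bounded (range x)"
  using lipschitz bounded_subset by (auto simp: lipschitz_gradients_along_def)

lemma velocity_step:
  assumes "k \<ge> 1"
  shows "(1 + \<alpha> * h) *\<^sub>R v (Suc k) = v k - h\<^sup>2 *\<^sub>R g k"
proof -
  have "v (Suc k) = (1 / (1 + \<alpha> * h)) *\<^sub>R v k - (h\<^sup>2 / (1 + \<alpha> * h)) *\<^sub>R g k"
    using scheme[OF assms] by (simp add: v_def g_def)
  then show ?thesis using c_pos by (simp add: scaleR_diff_right)
qed

text \<open>
  The minimality of \<open>\<theta> k\<close> makes \<open>h\<^sup>2 g k\<close> the projection of \<open>v k\<close> onto the set of all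
  \<open>h\<^sup>2 (\<Sum>\<^sub>i \<eta>\<^sub>i \<nabla>f\<^sub>i (x k))\<close>. By the recursion the residual \<open>v k - h\<^sup>2 g k\<close> is \<open>(1 + \<alpha> h) v (k + 1)\<close>, and the
  variational inequality of the projection is tested with the vertices of the simplex.
\<close>

lemma steepest_common_direction:
  assumes "k \<ge> 1"
  shows "inner (v (Suc k)) (gradient (f i) (x k)) \<le> inner (v (Suc k)) (g k)"
proof -
  define T where "T \<eta> = h\<^sup>2 *\<^sub>R (\<Sum>i\<in>UNIV. \<eta> $ i *\<^sub>R gradient (f i) (x k))" for \<eta> :: "real ^ 'm"
  have lin: "linear T"
    by (rule linearI)
      (simp_all add: T_def scaleR_add_left sum.distrib scaleR_add_right scaleR_sum_right mult_ac)
  have conv: "convex (T ` unit_simplex)"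
    by (rule convex_linear_image[OF lin convex_unit_simplex])
  have "compact (T ` unit_simplex)"
    unfolding T_def by (intro compact_continuous_image compact_unit_simplex continuous_intros)
  then have clo: "closed (T ` unit_simplex)" by (rule compact_imp_closed)
  have "dist (v k) (T (\<theta> k)) \<le> dist (v k) (T \<eta>)" if "\<eta> \<in> unit_simplex" for \<eta>
    using argmin[OF assms] that
    by (auto simp: is_arg_min_linorder T_def v_def dist_norm norm_minus_commute
        intro: power2_le_imp_le)
  then have min: "\<forall>z\<in>T ` unit_simplex. dist (v k) (T (\<theta> k)) \<le> dist (v k) z" by blast
  have "inner (v k - T (\<theta> k)) (T (axis i 1) - T (\<theta> k)) \<le> 0"
    using theta_simplex[OF assms] axis_in_unit_simplex
    by (intro any_closest_point_dot[OF conv clo _ _ min]) auto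
  moreover have "T (axis i 1) = h\<^sup>2 *\<^sub>R gradient (f i) (x k)"
    by (simp add: T_def axis_def if_distrib[of "\<lambda>a. a *\<^sub>R _"] cong: if_cong)
  moreover have "T (\<theta> k) = h\<^sup>2 *\<^sub>R g k" by (simp add: T_def g_def)
  ultimately have "h\<^sup>2 * ((1 + \<alpha> * h) * inner (v (Suc k)) (gradient (f i) (x k) - g k)) \<le> 0"
    by (simp flip: velocity_step[OF assms] scaleR_diff_right)
  then have "inner (v (Suc k)) (gradient (f i) (x k) - g k) \<le> 0"
    using c_pos h_pos by (simp add: mult_le_0_iff)
  then show ?thesis by (simp add: inner_diff_right)
qed

text \<open>
  The descent inequality bounds the increase of \<open>f i\<close> by \<open>\<langle>v (k + 1), g k\<rangle>\<close> and a quadratic error. By the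
  recursion, \<open>h\<^sup>2 \<langle>v (k + 1), g k\<rangle>\<close> equals \<open>\<langle>v (k + 1), v k\<rangle> - (1 + \<alpha> h) \<parallel>v (k + 1)\<parallel>\<^sup>2\<close>, which bounds it by
  the decrease of the kinetic term minus the damping \<open>\<alpha> h \<parallel>v (k + 1)\<parallel>\<^sup>2\<close>.
\<close>

lemma energy_decrease:
  "energy i (Suc k) + (\<alpha> / h - L / 2) * (norm (v (Suc k)))\<^sup>2 \<le> energy i k"
proof (cases "k \<ge> 1")
  case False
  then have "k = 0" by simp
  then show ?thesis using start by (simp add: energy_def v_start)
next
  case True
  have vS: "v (Suc k) = x (Suc k) - x k" by (simp add: v_def)
  have "f i (x (Suc k)) \<le> f i (x k) + inner (gradient (f i) (x k)) (v (Suc k))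
      + L / 2 * (norm (v (Suc k)))\<^sup>2"
    unfolding vS
  proof (rule descent_inequality[OF differentiable_f])
    show "L-lipschitz_on (closed_segment (x k) (x (Suc k))) (gradient (f i))"
      using lipschitz unfolding lipschitz_gradients_along_def by (meson lipschitz_on_subset)
  qed
  moreover have "inner (gradient (f i) (x k)) (v (Suc k)) \<le> inner (v (Suc k)) (g k)"
    using steepest_common_direction[OF True] by (simp add: inner_commute)
  moreover have "inner (v (Suc k)) (g k)
      \<le> (norm (v k))\<^sup>2 / (2 * h\<^sup>2) - (norm (v (Suc k)))\<^sup>2 / (2 * h\<^sup>2) - \<alpha> / h * (norm (v (Suc k)))\<^sup>2"
  proof -
    have "h\<^sup>2 *\<^sub>R g k = v k - (1 + \<alpha> * h) *\<^sub>R v (Suc k)"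
      using velocity_step[OF True] by (simp add: algebra_simps)
    then have "h\<^sup>2 * inner (v (Suc k)) (g k) = inner (v (Suc k)) (v k) - (1 + \<alpha> * h) * (norm (v (Suc k)))\<^sup>2"
      by (metis inner_diff_right inner_scaleR_right power2_norm_eq_inner)
    moreover have "2 * inner (v (Suc k)) (v k) \<le> (norm (v k))\<^sup>2 + (norm (v (Suc k)))\<^sup>2"
      using zero_le_power2[of "norm (v (Suc k) - v k)"]
      by (simp add: power2_norm_eq_inner inner_simps inner_commute)
    ultimately have "2 * (h\<^sup>2 * inner (v (Suc k)) (g k))
        \<le> (norm (v k))\<^sup>2 - (norm (v (Suc k)))\<^sup>2 - 2 * (\<alpha> * h) * (norm (v (Suc k)))\<^sup>2"
      by (simp add: algebra_simps)
    then have "inner (v (Suc k)) (g k)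
        \<le> ((norm (v k))\<^sup>2 - (norm (v (Suc k)))\<^sup>2 - 2 * (\<alpha> * h) * (norm (v (Suc k)))\<^sup>2) / (2 * h\<^sup>2)"
      using h_pos by (simp add: pos_le_divide_eq mult_ac)
    also have "\<dots> = (norm (v k))\<^sup>2 / (2 * h\<^sup>2) - (norm (v (Suc k)))\<^sup>2 / (2 * h\<^sup>2)
        - \<alpha> / h * (norm (v (Suc k)))\<^sup>2"
      using h_pos by (simp add: diff_divide_distrib power2_eq_square)
    finally show ?thesis .
  qed
  ultimately show ?thesis by (simp add: energy_def algebra_simps)
qed

lemma energy_rate_pos: "\<alpha> / h - L / 2 > 0"
  using step_size h_pos by (simp add: field_simps)

lemma energy_convergent:
  shows "energy i \<longlonglongrightarrow> limit_value i" and "limit_value i \<le> energy i k"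
proof -
  have dec: "decseq (energy i)"
    unfolding decseq_Suc_iff
  proof
    fix k
    have "0 \<le> (\<alpha> / h - L / 2) * (norm (v (Suc k)))\<^sup>2" using energy_rate_pos by simp
    then show "energy i (Suc k) \<le> energy i k" using energy_decrease[of i k] by linarith
  qed
  obtain B where B: "\<And>k. norm (x k) \<le> B" using bounded_x by (auto simp: bounded_iff)
  \<comment> \<open>The tangent plane at the origin bounds the convex function \<open>f i\<close> from below on the bounded orbit.\<close>
  have "f i 0 - norm (gradient (f i) 0) * B \<le> energy i k" for k
  proof -
    have "f i 0 + inner (gradient (f i) 0) (x k) \<le> f i (x k)"
      using convex_gradient_inequality[OF convex_f differentiable_f, of i 0 "x k"] by simp
    moreover have "\<bar>inner (gradient (f i) 0) (x k)\<bar> \<le> norm (gradient (f i) 0) * B"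
      using Cauchy_Schwarz_ineq2[of "gradient (f i) 0" "x k"]
        mult_left_mono[OF B[of k], of "norm (gradient (f i) 0)"] by simp
    moreover have "0 \<le> (norm (v k))\<^sup>2 / (2 * h\<^sup>2)" by simp
    ultimately show ?thesis unfolding energy_def by linarith
  qed
  then obtain l where "energy i \<longlonglongrightarrow> l"
    using decseq_convergent[OF dec] by metis
  then show lim: "energy i \<longlonglongrightarrow> limit_value i" unfolding limit_value_def by (simp add: limI)
  show "limit_value i \<le> energy i k" by (rule decseq_ge[OF dec lim])
qed

lemma summable_velocity: "summable (\<lambda>k. (norm (v k))\<^sup>2)"
proof -
  fix i :: 'm
  have "summable (\<lambda>k. (\<alpha> / h - L / 2) * (norm (v (Suc k)))\<^sup>2)"
  proof (rule summable_comparison_test')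
    show "summable (\<lambda>k. energy i k - energy i (Suc k))"
      by (rule telescope_summable'[OF energy_convergent(1)])
    show "norm ((\<alpha> / h - L / 2) * (norm (v (Suc k)))\<^sup>2) \<le> energy i k - energy i (Suc k)" for k
      using energy_decrease[of i k] energy_rate_pos by (simp add: abs_mult)
  qed
  then have "summable (\<lambda>k. (norm (v (Suc k)))\<^sup>2)"
    using energy_rate_pos by (subst (asm) summable_cmult_iff) auto
  then show ?thesis by (subst (asm) summable_Suc_iff)
qed

lemma v_tendsto_0: "v \<longlonglongrightarrow> 0"
proof -
  have "(\<lambda>k. sqrt ((norm (v k))\<^sup>2)) \<longlonglongrightarrow> sqrt 0"
    by (intro tendsto_real_sqrt summable_LIMSEQ_zero summable_velocity)
  then show ?thesis by (simp add: tendsto_norm_zero_iff)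
qed

lemma values_convergent: "(\<lambda>k. f i (x k)) \<longlonglongrightarrow> limit_value i"
proof -
  have "(\<lambda>k. energy i k - (norm (v k))\<^sup>2 / (2 * h\<^sup>2)) \<longlonglongrightarrow> limit_value i - 0 / (2 * h\<^sup>2)"
    using h_pos
    by (intro tendsto_intros energy_convergent summable_LIMSEQ_zero summable_velocity) auto
  then show ?thesis by (simp add: energy_def)
qed

lemma g_tendsto_0: "(\<lambda>k. g (Suc k)) \<longlonglongrightarrow> 0"
proof -
  have "g (Suc k) = (1 / h\<^sup>2) *\<^sub>R (v (Suc k) - (1 + \<alpha> * h) *\<^sub>R v (Suc (Suc k)))" for k
    using velocity_step[of "Suc k"] h_pos by simp
  moreover have "(\<lambda>k. (1 / h\<^sup>2) *\<^sub>R (v (Suc k) - (1 + \<alpha> * h) *\<^sub>R v (Suc (Suc k))))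
      \<longlonglongrightarrow> (1 / h\<^sup>2) *\<^sub>R (0 - (1 + \<alpha> * h) *\<^sub>R 0)"
    by (intro tendsto_intros LIMSEQ_Suc v_tendsto_0)
  ultimately show ?thesis by simp
qed

lemma weighted_gradient_inequality:
  assumes "k \<ge> 1"
  shows "(\<Sum>i\<in>UNIV. \<theta> k $ i * f i (x k)) + inner (g k) (y - x k) \<le> (\<Sum>i\<in>UNIV. \<theta> k $ i * f i y)"
proof -
  have "(\<Sum>i\<in>UNIV. \<theta> k $ i * (f i (x k) + inner (gradient (f i) (x k)) (y - x k)))
      \<le> (\<Sum>i\<in>UNIV. \<theta> k $ i * f i y)"
    using theta_simplex[OF assms]
    by (intro sum_mono mult_left_mono convex_gradient_inequality convex_f differentiable_f)
      (auto simp: unit_simplex_def)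
  then show ?thesis
    by (simp add: g_def inner_sum_left distrib_left sum.distrib)
qed

text \<open>
  Testing the recursion with \<open>x k - z\<close> leaves the term \<open>\<langle>g k, z - x k\<rangle>\<close>, which by convexity is at most a
  weighted mean of the \<open>f i z - f i (x k)\<close>. These differences are at most \<open>\<parallel>v k\<parallel>\<^sup>2 / (2 h\<^sup>2)\<close> because the
  energies stay above their limits. The remaining inner products are differences of
  consecutive squared distances to \<open>z\<close>.
\<close>

lemma quasi_fejer:
  assumes z: "\<And>i. f i z \<le> limit_value i"
  shows "(1 + \<alpha> * h) * (norm (x (Suc k) - z))\<^sup>2 - (norm (x k - z))\<^sup>2
      \<le> (1 + \<alpha> * h) * (norm (x k - z))\<^sup>2 - (norm (x (k - 1) - z))\<^sup>2
        + (2 * (norm (v k))\<^sup>2 + (1 + \<alpha> * h) * (norm (v (Suc k)))\<^sup>2)"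
proof (cases "k \<ge> 1")
  case False
  then have "k = 0" by simp
  then show ?thesis using start by (simp add: v_start)
next
  case True
  define c where "c = 1 + \<alpha> * h"
  have simplex: "\<And>i. 0 \<le> \<theta> k $ i" "(\<Sum>i\<in>UNIV. \<theta> k $ i) = 1"
    using theta_simplex[OF True] by (auto simp: unit_simplex_def)
  have "inner (g k) (z - x k) \<le> (\<Sum>i\<in>UNIV. \<theta> k $ i * (f i z - f i (x k)))"
    using weighted_gradient_inequality[OF True, of z]
    by (simp add: right_diff_distrib sum_subtractf)
  also have "\<dots> \<le> (\<Sum>i\<in>UNIV. \<theta> k $ i * ((norm (v k))\<^sup>2 / (2 * h\<^sup>2)))"
  proof (intro sum_mono mult_left_mono simplex)
    fix i show "f i z - f i (x k) \<le> (norm (v k))\<^sup>2 / (2 * h\<^sup>2)"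
      using z[of i] energy_convergent(2)[of i k] by (simp add: energy_def)
  qed
  also have "\<dots> = (norm (v k))\<^sup>2 / (2 * h\<^sup>2)"
    using simplex(2) by (simp flip: sum_distrib_right sum_divide_distrib)
  finally have "2 * (h\<^sup>2 * inner (g k) (z - x k)) \<le> (norm (v k))\<^sup>2"
    using h_pos by (simp add: field_simps)
  moreover have "h\<^sup>2 * inner (g k) (z - x k) = inner (v k - c *\<^sub>R v (Suc k)) (z - x k)"
    using velocity_step[OF True] by (simp add: c_def flip: inner_scaleR_left)
  ultimately have key: "2 * c * inner (v (Suc k)) (x k - z) - 2 * inner (v k) (x k - z) \<le> (norm (v k))\<^sup>2"
    by (simp add: inner_diff_left inner_diff_right algebra_simps)
  have next_: "2 * inner (v (Suc k)) (x k - z)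
      = (norm (x (Suc k) - z))\<^sup>2 - (norm (x k - z))\<^sup>2 - (norm (v (Suc k)))\<^sup>2"
    by (simp add: v_def power2_norm_eq_inner inner_simps inner_commute algebra_simps)
  have prev: "2 * inner (v k) (x k - z)
      = (norm (x k - z))\<^sup>2 - (norm (x (k - 1) - z))\<^sup>2 + (norm (v k))\<^sup>2"
    by (simp add: v_def power2_norm_eq_inner inner_simps inner_commute algebra_simps)
  have "c * (2 * inner (v (Suc k)) (x k - z)) - 2 * inner (v k) (x k - z) \<le> (norm (v k))\<^sup>2"
    using key by (simp add: mult_ac)
  then show ?thesis
    unfolding next_ prev by (simp add: algebra_simps flip: c_def)
qed

text \<open>
  With \<open>U k = \<parallel>x k - z\<parallel>\<^sup>2\<close>, the preceding inequality says that \<open>W k = (1 + \<alpha> h) U k - U (k - 1)\<close> decreases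
  up to a summable error. Since \<open>W k\<close> is \<open>\<alpha> h U k\<close> plus the increment \<open>U k - U (k - 1)\<close>, which
  vanishes in the limit, the convergence passes from \<open>W\<close> to \<open>U\<close>.
\<close>

lemma distance_convergent:
  assumes z: "\<And>i. f i z \<le> limit_value i"
  shows "convergent (\<lambda>k. (norm (x k - z))\<^sup>2)"
proof -
  define c where "c = 1 + \<alpha> * h"
  define U where "U k = (norm (x k - z))\<^sup>2" for k
  define W where "W k = c * U k - U (k - 1)" for k
  have bxz: "bounded (range (\<lambda>k. x k - z))"
    using bounded_translation[OF bounded_x, of "- z"] by (simp add: image_image)
  then obtain B where B: "\<And>k. norm (x k - z) \<le> B" by (auto simp: bounded_iff)
  have "convergent W"
  proof (rule almost_decreasing_convergent)
    show "W (Suc k) \<le> W k + (2 * (norm (v k))\<^sup>2 + c * (norm (v (Suc k)))\<^sup>2)" for k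
      using quasi_fejer[OF z, of k] by (simp add: W_def U_def c_def)
    show "summable (\<lambda>k. 2 * (norm (v k))\<^sup>2 + c * (norm (v (Suc k)))\<^sup>2)"
      using summable_velocity summable_Suc_iff[of "\<lambda>k. (norm (v k))\<^sup>2"]
      by (intro summable_add summable_mult) auto
    show "- B\<^sup>2 \<le> W k" for k
    proof -
      have "U (k - 1) \<le> B\<^sup>2" unfolding U_def using B by (simp add: power_mono)
      moreover have "0 \<le> c * U k" using c_pos by (simp add: c_def U_def)
      ultimately show ?thesis by (simp add: W_def)
    qed
  qed
  then obtain w where w: "W \<longlonglongrightarrow> w" by (auto simp: convergent_def)
  have "U k = (W k - (2 * inner (v k) (x k - z) - (norm (v k))\<^sup>2)) / (\<alpha> * h)" for k
  proof -
    have "U k - U (k - 1) = 2 * inner (v k) (x k - z) - (norm (v k))\<^sup>2"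
      by (simp add: U_def v_def power2_norm_eq_inner inner_simps inner_commute algebra_simps)
    then show ?thesis using alpha_pos h_pos by (simp add: W_def c_def field_simps)
  qed
  moreover have "(\<lambda>k. (W k - (2 * inner (v k) (x k - z) - (norm (v k))\<^sup>2)) / (\<alpha> * h))
      \<longlonglongrightarrow> (w - (2 * 0 - 0)) / (\<alpha> * h)"
    using alpha_pos h_pos
    by (intro tendsto_intros w tendsto_inner_zero_bounded v_tendsto_0 bxz
        summable_LIMSEQ_zero summable_velocity) auto
  ultimately have "U \<longlonglongrightarrow> (w - (2 * 0 - 0)) / (\<alpha> * h)" by presburger
  then show ?thesis unfolding U_def convergent_def by blast
qed

text \<open>
  Let \<open>\<eta>\<close> be the limit of a subsequence of the weights. Passing to the limit in the weighted gradient
  inequality, with \<open>g k\<close> tending to 0, gives \<open>\<Sum>\<^sub>i \<eta>\<^sub>i \<ell>\<^sub>i \<le> \<Sum>\<^sub>i \<eta>\<^sub>i f\<^sub>i y\<close> for all \<open>y\<close>, where \<open>\<ell>\<^sub>i\<close> is the limit of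
  \<open>f\<^sub>i (x k)\<close>. So \<open>z\<close> minimises the weighted sum, whose gradient vanishes there.
\<close>

lemma below_limit_values_pareto_critical:
  assumes z: "\<And>i. f i z \<le> limit_value i"
  shows "pareto_critical f z"
proof -
  have "\<forall>n. \<theta> (Suc n) \<in> unit_simplex" using theta_simplex by simp
  then obtain \<eta> r where \<eta>: "\<eta> \<in> unit_simplex" and r: "strict_mono (r :: nat \<Rightarrow> nat)"
    and lim_\<theta>: "((\<lambda>n. \<theta> (Suc n)) \<circ> r) \<longlonglongrightarrow> \<eta>"
    using seq_compactE[OF compact_imp_seq_compact[OF compact_unit_simplex], of "\<lambda>n. \<theta> (Suc n)"]
    by metis
  have lim_i: "(\<lambda>n. \<theta> (Suc (r n)) $ i) \<longlonglongrightarrow> \<eta> $ i" for i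
    using tendsto_vec_nth[OF lim_\<theta>, of i] by (simp add: o_def)
  have minimal: "(\<Sum>i\<in>UNIV. \<eta> $ i * f i z) \<le> (\<Sum>i\<in>UNIV. \<eta> $ i * f i y)" for y
  proof -
    have "(\<Sum>i\<in>UNIV. \<eta> $ i * limit_value i) + 0 \<le> (\<Sum>i\<in>UNIV. \<eta> $ i * f i y)"
    proof (rule LIMSEQ_le)
      obtain B where "\<And>k. norm (x k) \<le> B" using bounded_x by (auto simp: bounded_iff)
      then have "norm (y - x (Suc k)) \<le> norm y + B" for k
        using norm_triangle_ineq4[of y "x (Suc k)"] by (meson add_left_mono order_trans)
      then have "bounded (range (\<lambda>k. y - x (Suc k)))" by (intro boundedI) blast
      then have "(\<lambda>k. inner (g (Suc k)) (y - x (Suc k))) \<longlonglongrightarrow> 0"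
        by (intro tendsto_inner_zero_bounded g_tendsto_0)
      then have "(\<lambda>n. inner (g (Suc (r n))) (y - x (Suc (r n)))) \<longlonglongrightarrow> 0"
        using LIMSEQ_subseq_LIMSEQ[OF _ r] by (fastforce simp: o_def)
      moreover have "(\<lambda>n. f i (x (Suc (r n)))) \<longlonglongrightarrow> limit_value i" for i
        using LIMSEQ_subseq_LIMSEQ[OF LIMSEQ_Suc[OF values_convergent] r] by (simp add: o_def)
      ultimately show "(\<lambda>n. (\<Sum>i\<in>UNIV. \<theta> (Suc (r n)) $ i * f i (x (Suc (r n))))
            + inner (g (Suc (r n))) (y - x (Suc (r n))))
          \<longlonglongrightarrow> (\<Sum>i\<in>UNIV. \<eta> $ i * limit_value i) + 0"
        by (intro tendsto_add tendsto_sum tendsto_mult lim_i)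
      show "(\<lambda>n. \<Sum>i\<in>UNIV. \<theta> (Suc (r n)) $ i * f i y) \<longlonglongrightarrow> (\<Sum>i\<in>UNIV. \<eta> $ i * f i y)"
        by (intro tendsto_sum tendsto_mult lim_i tendsto_const)
    qed (use weighted_gradient_inequality in auto)
    moreover have "(\<Sum>i\<in>UNIV. \<eta> $ i * f i z) \<le> (\<Sum>i\<in>UNIV. \<eta> $ i * limit_value i)"
      using \<eta> z by (intro sum_mono mult_left_mono) (auto simp: unit_simplex_def)
    ultimately show ?thesis by simp
  qed
  define D where "D = (\<Sum>i\<in>UNIV. \<eta> $ i *\<^sub>R gradient (f i) z)"
  have "((\<lambda>y. \<Sum>i\<in>UNIV. \<eta> $ i * f i y) has_derivative
      (\<lambda>w. \<Sum>i\<in>UNIV. \<eta> $ i * inner w (gradient (f i) z))) (at z)"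
    using gderiv_gradient[OF differentiable_f]
    by (intro has_derivative_sum has_derivative_mult_right) (simp add: gderiv_def)
  then have "(\<lambda>w. \<Sum>i\<in>UNIV. \<eta> $ i * inner w (gradient (f i) z)) = (\<lambda>w. 0)"
    by (rule differential_zero_maxmin[where S = UNIV, rotated 2]) (use minimal in auto)
  then have "inner D D = 0"
    by (simp add: D_def inner_sum_right fun_eq_iff)
  then show ?thesis using \<eta> by (auto simp: pareto_critical_def D_def)
qed

lemma weak_limit_pareto_critical: "\<exists>x'. converges_weakly x x' \<and> pareto_critical f x'"
proof -
  define Z where "Z = {z. \<forall>i. f i z \<le> limit_value i}"
  obtain p where "p \<in> Z" "converges_weakly x p"
  proof (rule opial_weak_convergence[OF bounded_x])
    show "convergent (\<lambda>k. (norm (x k - z))\<^sup>2)" if "z \<in> Z" for z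
      using that by (intro distance_convergent) (simp add: Z_def)
    fix r :: "nat \<Rightarrow> nat" and q
    assume r: "strict_mono r" and q: "\<And>n. q \<in> tail_hull (x \<circ> r) n"
    have "f i q \<le> limit_value i" for i
    proof (rule convex_le_limit_on_tail_hull[OF convex_f _ q])
      show "continuous_on UNIV (f i)"
        by (intro continuous_at_imp_continuous_on ballI differentiable_imp_continuous_within
            differentiable_f)
      show "(\<lambda>k. f i ((x \<circ> r) k)) \<longlonglongrightarrow> limit_value i"
        using LIMSEQ_subseq_LIMSEQ[OF values_convergent r] by (simp add: o_def)
    qed
    then show "q \<in> Z" by (simp add: Z_def)
  qed
  then show ?thesis using below_limit_values_pareto_critical by (auto simp: Z_def)
qed

end

theorem theorem5p6:
  fixes f :: "'m::finite \<Rightarrow> 'a::{real_inner, complete_space} \<Rightarrow> real"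
    and x :: "nat \<Rightarrow> 'a"
    and \<theta> :: "nat \<Rightarrow> real ^ 'm"
    and \<alpha> h L :: real
  assumes "\<alpha> > 0" and "h > 0" and "L > 0"
    and "\<And>i. convex_on UNIV (f i)"
    and "\<And>i y. f i differentiable (at y)"
    and "x 0 = x 1"
    and "\<And>k. k \<ge> 1 \<Longrightarrow>
           x (k + 1) = x k + (1 / (1 + \<alpha> * h)) *\<^sub>R (x k - x (k - 1))
             - (h\<^sup>2 / (1 + \<alpha> * h)) *\<^sub>R (\<Sum>i\<in>UNIV. \<theta> k $ i *\<^sub>R gradient (f i) (x k))"
    and "\<And>k. k \<ge> 1 \<Longrightarrow>
           is_arg_min
             (\<lambda>\<eta>. (norm (h\<^sup>2 *\<^sub>R (\<Sum>i\<in>UNIV. \<eta> $ i *\<^sub>R gradient (f i) (x k)) - (x k - x (k - 1))))\<^sup>2)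
             (\<lambda>\<eta>. \<eta> \<in> unit_simplex) (\<theta> k)"
    and "\<exists>S. lipschitz_gradients_along L f x S"
    and "L * h < 2 * \<alpha>"
  shows "\<exists>x'. converges_weakly x x' \<and> pareto_critical f x'"
proof -
  obtain S where "lipschitz_gradients_along L f x S"
    using assms(9) by blast
  with assms interpret inertial_multiobjective_scheme f x \<theta> \<alpha> h L S
    by unfold_locales
  show ?thesis by (rule weak_limit_pareto_critical)
qed

end
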